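(* Let a directed weighted graph on $n$ nodes with Laplacian $L$, a leader set and a target set with $p$ elements be fixed, and let $B\in\mathbb{R}^{n\times l}$, $H\in\mathbb{R}^{p\times n}$ be the associated input and output matrices. For an order $m$, consider the high-order multiagent system $\dot X=\mathcal{A}X+\mathcal{B}U$, $Y=\mathcal{H}X$, with $$\mathcal{A}=\begin{bmatrix} 0_n & I_n & 0_n & \cdots & 0_n \\ 0_n & 0_n & I_n & \cdots & 0_n \\ \vdots & \vdots & \vdots & \ddots & \vdots \\ 0_n & 0_n & 0_n & \cdots & I_n \\ -L & 0_n & 0_n & \cdots & 0_n \end{bmatrix}\in\mathbb{R}^{nm\times nm},\quad \mathcal{B}=\begin{bmatrix} 0_{n\times l} \\ \vdots \\ 0_{n\times l} \\ {B} \end{bmatrix}\in\mathbb{R}^{nm\times l},\quad \mathcal{H}=[H,0_{p\times n},\dots,0_{p\times n}]\in\mathbb{R}^{p\times nm}.$$ Then this high-order system is target controllable if and only if the first-order multiagent system $\dot x=-Lx+Bu$, $y=Hx$ is target controllable.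
   Context: Graph: $\mathcal{G}$ is a simple directed weighted graph (no self-loops, no multiple edges) with nodes $v_1,\dots,v_n$; $a_{ij}=w_{ij}$ is the weight of the edge from $v_j$ to $v_i$ if it exists ($i\neq j$), and $a_{ij}=0$ otherwise. The Laplacian $L=[l_{ij}]$ has $l_{ii}=\sum_{k\neq i}a_{ik}$ and $l_{ij}=-a_{ij}$ for $i\ne j$. Leader set $\mathcal{V}_L=\{v_1,\dots,v_l\}$, target set $\mathcal{V}_T=\{\bar v_1,\dots,\bar v_p\}\subseteq\mathcal{V}$; $B=[e_{v_1},\dots,e_{v_l}]$, $H=[e_{\bar v_1},\dots,e_{\bar v_p}]^T$, with $e_i$ the standard basis vector indexed by the node. The high-order system is the compact form of the dynamics $x_i^{(m)}=\sum_{j\in\mathcal{N}_i}a_{ij}(x_j-x_i)+u_i$ for leaders (with no $u_i$ for followers), where $X$ stacks $x_1,\dots,x_n$ and their derivatives up to order $m-1$, and the output consists of the states $x_i$ of target nodes; $m\geq1$ is an integer. A linear system $\dot x=Fx+Gu$, $y=Jx$ with output in $\mathbb{R}^p$ is called target controllable (output controllable) if for any initial state $x(t_0)$ and any $y_f\in\mathbb{R}^p$ there is a control input $u$ with $y(t_f)=y_f$ ($t_0<t_f$ finite); equivalently, $[JG,JFG,\dots,JF^{N-1}G]$ has rank $p$, where $N$ is the state dimension. *)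

theory Defs
  imports "Graph_Theory.Pair_Digraph" "Jordan_Normal_Form.Matrix" Complex_Main
begin

text \<open>
  Vertices are \<open>0, \<dots>, n - 1\<close>. An arc is a pair \<open>(tail, head)\<close>, so the weight in row \<open>i\<close>,
  column \<open>j\<close> is that of the arc from \<open>j\<close> to \<open>i\<close>. Weights are arbitrary reals.
\<close>

definition adj_weight :: "nat pair_pre_digraph \<Rightarrow> (nat \<times> nat \<Rightarrow> real) \<Rightarrow> nat \<Rightarrow> nat \<Rightarrow> real" where
  "adj_weight G w i j = (if (j, i) \<in> parcs G then w (j, i) else 0)"

definition laplacian :: "nat \<Rightarrow> nat pair_pre_digraph \<Rightarrow> (nat \<times> nat \<Rightarrow> real) \<Rightarrow> real mat" where
  "laplacian n G w = mat n n (\<lambda>(i, j).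
     if i = j then (\<Sum>k \<in> {0..<n} - {i}. adj_weight G w i k) else - adj_weight G w i j)"

definition leader_mat :: "nat \<Rightarrow> nat list \<Rightarrow> real mat" where
  "leader_mat n ls = mat_of_cols n (map (unit_vec n) ls)"

definition target_mat :: "nat \<Rightarrow> nat list \<Rightarrow> real mat" where
  "target_mat n ts = mat_of_rows n (map (unit_vec n) ts)"

text \<open>
  The block matrices of order \<open>m\<close>: index \<open>i < n * m\<close> is position \<open>i mod n\<close> inside
  block \<open>i div n\<close>, blocks being numbered \<open>0, \<dots>, m - 1\<close>. For \<open>m = 1\<close> the last block row is
  also the first one, and the three matrices are \<open>- L\<close>, \<open>B\<close> and \<open>H\<close>.
\<close>

definition high_order_state_mat :: "nat \<Rightarrow> real mat \<Rightarrow> real mat" where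
  "high_order_state_mat m L = (let n = dim_row L in
     mat (n * m) (n * m) (\<lambda>(i, j).
       (if i div n = m - 1 then (if j div n = 0 then - L else 0\<^sub>m n n)
        else if j div n = i div n + 1 then 1\<^sub>m n
        else 0\<^sub>m n n) $$ (i mod n, j mod n)))"

definition high_order_input_mat :: "nat \<Rightarrow> real mat \<Rightarrow> real mat" where
  "high_order_input_mat m B = (let n = dim_row B; l = dim_col B in
     mat (n * m) l (\<lambda>(i, j).
       (if i div n = m - 1 then B else 0\<^sub>m n l) $$ (i mod n, j)))"

definition high_order_output_mat :: "nat \<Rightarrow> real mat \<Rightarrow> real mat" where
  "high_order_output_mat m H = (let p = dim_row H; n = dim_col H in
     mat p (n * m) (\<lambda>(i, j).
       (if j div n = 0 then H else 0\<^sub>m p n) $$ (i, j mod n)))"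

text \<open>
  Admissible inputs are piecewise continuous: finitely many discontinuities, with finite
  one-sided limits everywhere. (At an end point of the interval one of the two one-sided
  filters is trivial, so that only the inner limit is required there.)
\<close>

definition piecewise_continuous :: "real \<Rightarrow> real \<Rightarrow> (real \<Rightarrow> real) \<Rightarrow> bool" where
  "piecewise_continuous a b f \<longleftrightarrow>
     (\<exists>S. finite S \<and> continuous_on ({a..b} - S) f) \<and>
     (\<forall>s \<in> {a..b}. (\<exists>c. (f \<longlongrightarrow> c) (at s within {a..<s})) \<and>
                   (\<exists>c. (f \<longlongrightarrow> c) (at s within {s<..b})))"

definition admissible_input :: "nat \<Rightarrow> real \<Rightarrow> real \<Rightarrow> (real \<Rightarrow> real vec) \<Rightarrow> bool" where
  "admissible_input r t0 tf u \<longleftrightarrow>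
     (\<forall>t \<in> {t0..tf}. u t \<in> carrier_vec r) \<and>
     (\<forall>i < r. piecewise_continuous t0 tf (\<lambda>t. u t $ i))"

text \<open>
  Continuous solutions \<open>x\<close> of \<open>x' = F x + G u\<close> on \<open>{t0..tf}\<close>; the equation may fail
  at finitely many times, as it must where \<open>u\<close> jumps.
\<close>

definition state_trajectory ::
  "real mat \<Rightarrow> real mat \<Rightarrow> real \<Rightarrow> real \<Rightarrow> (real \<Rightarrow> real vec) \<Rightarrow> (real \<Rightarrow> real vec) \<Rightarrow> bool" where
  "state_trajectory F G t0 tf u x \<longleftrightarrow>
     (\<forall>t \<in> {t0..tf}. x t \<in> carrier_vec (dim_row F)) \<and>
     (\<forall>i < dim_row F. continuous_on {t0..tf} (\<lambda>t. x t $ i)) \<and>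
     (\<exists>S. finite S \<and> (\<forall>t \<in> {t0..tf} - S. \<forall>i < dim_row F.
        ((\<lambda>s. x s $ i) has_real_derivative (F *\<^sub>v x t + G *\<^sub>v u t) $ i) (at t within {t0..tf})))"

definition target_controllable :: "real mat \<Rightarrow> real mat \<Rightarrow> real mat \<Rightarrow> bool" where
  "target_controllable F G J \<longleftrightarrow>
     (\<forall>t0. \<forall>x0 \<in> carrier_vec (dim_row F). \<forall>yf \<in> carrier_vec (dim_row J).
        \<exists>tf > t0. \<exists>u x. admissible_input (dim_col G) t0 tf u \<and>
          state_trajectory F G t0 tf u x \<and> x t0 = x0 \<and> J *\<^sub>v x tf = yf)"

end

theory Submission
  imports Defs
begin

text \<open>
  A system \<open>(F, G, J)\<close> is target controllable iff no nonzero row \<open>\<xi>\<close> satisfies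
  \<open>\<xi> J F^k G = 0\<close> for all \<open>k\<close>. If \<open>\<xi>\<close> does, then along a trajectory from \<open>0\<close> the
  functions \<open>z k = \<xi> J F^k x\<close> satisfy \<open>(z k)' = z (k + 1)\<close> and grow at most geometrically in
  \<open>k\<close>, so \<open>z 0\<close> vanishes by Taylor's estimate. If no \<open>\<xi>\<close> does, then inputs and states given by
  power series reach every output in unit time: the reachable outputs form a subspace, and a row
  \<open>\<xi>\<close> annihilating it kills \<open>\<Sum>j. \<xi> J F^j G / (K + 1 + j)!\<close> for every \<open>K\<close>, the output of the
  input \<open>t^K / K!\<close>; letting \<open>K\<close> grow, each coefficient vanishes in turn.

  For the high-order system, \<open>\<H> \<A>^k \<B>\<close> is \<open>H (- L)^q B\<close> if \<open>k = q m + m - 1\<close> and \<open>0\<close>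
  otherwise, so both systems have the same nonzero Markov parameters.
\<close>

subsection \<open>Exponential generating functions\<close>

text \<open>Geometric growth makes the exponential generating function entire. The class is closed
  under linear combinations and shifts, which is all that a linear system does to sequences of
  derivatives.\<close>

definition exp_bounded :: "(nat \<Rightarrow> real) \<Rightarrow> bool" where
  "exp_bounded a \<longleftrightarrow> (\<exists>C M. M \<ge> 0 \<and> (\<forall>k. \<bar>a k\<bar> \<le> C * M ^ k))"

text \<open>The function whose derivatives at 0 are the given sequence, so that differentiation
  becomes a shift of the index.\<close>

definition egf :: "(nat \<Rightarrow> real) \<Rightarrow> real \<Rightarrow> real" where
  "egf a t = (\<Sum>k. a k / fact k * t ^ k)"

lemma exp_boundedI: "M \<ge> 0 \<Longrightarrow> (\<And>k. \<bar>a k\<bar> \<le> C * M ^ k) \<Longrightarrow> exp_bounded a"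
  unfolding exp_bounded_def by blast

lemma exp_bounded_0 [simp]: "exp_bounded (\<lambda>k. 0)"
  by (rule exp_boundedI[of 0 _ 0]) auto

lemma exp_bounded_cmult:
  assumes "exp_bounded a"
  shows "exp_bounded (\<lambda>k. c * a k)"
proof -
  obtain C M where "M \<ge> 0" and b: "\<And>k. \<bar>a k\<bar> \<le> C * M ^ k"
    using assms unfolding exp_bounded_def by blast
  show ?thesis
  proof (rule exp_boundedI[OF \<open>M \<ge> 0\<close>])
    fix k show "\<bar>c * a k\<bar> \<le> (\<bar>c\<bar> * C) * M ^ k"
      using mult_left_mono[OF b[of k], of "\<bar>c\<bar>"] by (simp add: abs_mult mult.assoc)
  qed
qed

lemma exp_bounded_add:
  assumes "exp_bounded a" "exp_bounded b"
  shows "exp_bounded (\<lambda>k. a k + b k)"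
proof -
  obtain C M where "M \<ge> 0" and a: "\<And>k. \<bar>a k\<bar> \<le> C * M ^ k"
    using assms unfolding exp_bounded_def by blast
  obtain D N where "N \<ge> 0" and b: "\<And>k. \<bar>b k\<bar> \<le> D * N ^ k"
    using assms unfolding exp_bounded_def by blast
  have CD: "C \<ge> 0" "D \<ge> 0" using a[of 0] b[of 0] by auto
  show ?thesis
  proof (rule exp_boundedI)
    show "max M N \<ge> 0" using \<open>M \<ge> 0\<close> by simp
    fix k
    have "C * M ^ k \<le> C * max M N ^ k" "D * N ^ k \<le> D * max M N ^ k"
      using CD \<open>M \<ge> 0\<close> \<open>N \<ge> 0\<close> by (auto intro!: mult_left_mono power_mono)
    then show "\<bar>a k + b k\<bar> \<le> (C + D) * max M N ^ k"
      using a[of k] b[of k] by (simp add: distrib_right)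
  qed
qed

lemma exp_bounded_sum:
  "(\<And>i. i \<in> A \<Longrightarrow> exp_bounded (f i)) \<Longrightarrow> exp_bounded (\<lambda>k. \<Sum>i\<in>A. f i k)"
  by (induction A rule: infinite_finite_induct) (auto intro: exp_bounded_add)

lemma exp_bounded_shift:
  assumes "exp_bounded a"
  shows "exp_bounded (\<lambda>k. a (Suc k))"
proof -
  obtain C M where "M \<ge> 0" and a: "\<And>k. \<bar>a k\<bar> \<le> C * M ^ k"
    using assms unfolding exp_bounded_def by blast
  show ?thesis
    using a[of "Suc _"] by (intro exp_boundedI[OF \<open>M \<ge> 0\<close>, of _ "C * M"]) (simp add: mult.assoc)
qed

lemma summable_power_over_fact: "summable (\<lambda>k. c * (x::real) ^ k / fact k)"
  using summable_mult[OF summable_exp[of x], of c] by (simp add: field_simps)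

lemma egf_summable:
  assumes "exp_bounded a"
  shows "summable (\<lambda>k. a k / fact k * t ^ k)"
proof -
  obtain C M where "M \<ge> 0" and a: "\<And>k. \<bar>a k\<bar> \<le> C * M ^ k"
    using assms unfolding exp_bounded_def by blast
  have "norm (a k / fact k * t ^ k) \<le> C * (M * \<bar>t\<bar>) ^ k / fact k" for k
    using mult_right_mono[OF a[of k], of "\<bar>t\<bar> ^ k"]
    by (simp add: abs_mult power_abs power_mult_distrib mult.assoc divide_right_mono)
  then show ?thesis
    by (intro summable_comparison_test'[OF summable_power_over_fact[of C "M * \<bar>t\<bar>"]])
qed

lemma egf_cmult: "exp_bounded a \<Longrightarrow> egf (\<lambda>k. c * a k) t = c * egf a t"
  using suminf_mult[OF egf_summable[of a t], of c] by (simp add: egf_def mult.assoc)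

lemma egf_add:
  "exp_bounded a \<Longrightarrow> exp_bounded b \<Longrightarrow> egf (\<lambda>k. a k + b k) t = egf a t + egf b t"
  using suminf_add[OF egf_summable[of a t] egf_summable[of b t]]
  by (simp add: egf_def add_divide_distrib distrib_right)

lemma egf_sum:
  "(\<And>i. i \<in> A \<Longrightarrow> exp_bounded (f i)) \<Longrightarrow> egf (\<lambda>k. \<Sum>i\<in>A. f i k) t = (\<Sum>i\<in>A. egf (f i) t)"
  by (induction A rule: infinite_finite_induct)
    (auto simp: egf_add exp_bounded_sum, auto simp: egf_def)

lemma egf_linear_combination:
  assumes "\<And>i. i \<in> A \<Longrightarrow> exp_bounded (f i)"
  shows "egf (\<lambda>k. \<Sum>i\<in>A. c i * f i k) t = (\<Sum>i\<in>A. c i * egf (f i) t)"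
proof -
  have "egf (\<lambda>k. \<Sum>i\<in>A. c i * f i k) t = (\<Sum>i\<in>A. egf (\<lambda>k. c i * f i k) t)"
    using assms by (intro egf_sum exp_bounded_cmult)
  then show ?thesis using assms by (simp add: egf_cmult)
qed

lemma egf_at_0 [simp]: "egf a 0 = a 0"
proof -
  have "egf a 0 = (\<Sum>k. a k / fact k * 0 ^ k)" by (simp add: egf_def)
  also have "\<dots> = a 0 / fact 0" by (rule powser_zero)
  finally show ?thesis by simp
qed

lemma egf_has_derivative:
  assumes "exp_bounded a"
  shows "(egf a has_real_derivative egf (\<lambda>k. a (Suc k)) t) (at t)"
proof -
  have "((\<lambda>x. \<Sum>n. a n / fact n * x ^ n) has_real_derivative
      (\<Sum>n. diffs (\<lambda>n. a n / fact n) n * t ^ n)) (at t)"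
    by (rule termdiffs_strong_converges_everywhere) (rule egf_summable[OF assms])
  moreover have "diffs (\<lambda>n. a n / fact n) n = a (Suc n) / fact n" for n
    by (simp add: diffs_def divide_simps del: of_nat_Suc)
  ultimately show ?thesis by (simp add: egf_def[abs_def])
qed

text \<open>Applied with \<open>P = Suc K\<close>, this turns the output at unit time under the
  input t^K / K! into a tail series of Markov parameters.\<close>

lemma egf_shift_eq:
  assumes "exp_bounded b" and "\<And>k. k < P \<Longrightarrow> b k = 0"
  shows "egf b 1 = (\<Sum>i. b (P + i) / fact (P + i))"
proof -
  have s: "summable (\<lambda>k. b k / fact k)" using egf_summable[OF assms(1), of 1] by simp
  show ?thesis
    using suminf_split_initial_segment[OF s, of P] assms(2) by (simp add: egf_def add.commute)
qed

text \<open>The leading term of a series \<open>\<Sum>j. a j / (P + j)!\<close> dominates as \<open>P\<close> grows.\<close>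

lemma exp_bounded_tail_eq_0:
  assumes "exp_bounded a" and z: "\<And>P. P \<ge> P0 \<Longrightarrow> (\<Sum>j. a j / fact (P + j)) = 0"
  shows "a 0 = 0"
proof -
  obtain C M where "M \<ge> 0" and a: "\<And>k. \<bar>a k\<bar> \<le> C * M ^ k"
    using assms unfolding exp_bounded_def by blast
  define D where "D = (\<Sum>i. C * M * M ^ i / fact i)"
  have sD: "summable (\<lambda>i. C * M * M ^ i / fact i)" by (rule summable_power_over_fact)
  \<comment> \<open>Multiplying the vanishing series by (P + 1)! turns its leading term a 0 / P!
    into a 0 (P + 1), which is unbounded in P, while the other terms stay below the series
    \<open>D\<close>, which does not depend on P.\<close>
  have dominated: "\<bar>a 0\<bar> * real (Suc P) \<le> D" if "P \<ge> P0" for P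
  proof -
    have b: "norm (fact (Suc P) * (a (Suc i) / fact (P + Suc i))) \<le> C * M * M ^ i / fact i" for i
    proof -
      \<comment> \<open>Splitting (P + 1 + i)! into at least (P + 1)! i! cancels the scaling factor
        and leaves a bound free of P.\<close>
      have "(fact (Suc P) * fact i :: nat) dvd fact (Suc P + i)" by (rule fact_fact_dvd_fact)
      then have "(fact (Suc P) * fact i :: nat) \<le> fact (P + Suc i)" by (intro dvd_imp_le) auto
      then have "real (fact (Suc P) * fact i) \<le> real (fact (P + Suc i))" by (rule of_nat_mono)
      then have f: "fact (Suc P) * fact i \<le> (fact (P + Suc i) :: real)"
        unfolding of_nat_mult of_nat_fact .
      have "norm (fact (Suc P) * (a (Suc i) / fact (P + Suc i)))
          = fact (Suc P) * \<bar>a (Suc i)\<bar> / fact (P + Suc i)" by (simp add: abs_mult)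
      also have "\<dots> \<le> fact (Suc P) * \<bar>a (Suc i)\<bar> / (fact (Suc P) * fact i)"
        by (rule divide_left_mono[OF f]) (auto intro!: mult_pos_pos)
      also have "\<dots> = \<bar>a (Suc i)\<bar> / fact i" by (simp del: fact_Suc)
      also have "\<dots> \<le> C * M * M ^ i / fact i"
        using a[of "Suc i"] by (intro divide_right_mono) (auto simp: mult.assoc)
      finally show ?thesis .
    qed
    have s1: "summable (\<lambda>i. norm (fact (Suc P) * (a (Suc i) / fact (P + Suc i))))"
      by (rule summable_comparison_test'[OF sD]) (use b in auto)
    then have "summable (\<lambda>i. fact (Suc P) * (a (Suc i) / fact (P + Suc i)))"
      by (rule summable_norm_cancel)
    then have s2: "summable (\<lambda>i. a (Suc i) / fact (P + Suc i))"
      by (subst (asm) summable_cmult_iff) auto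
    have s3: "summable (\<lambda>i. a i / fact (P + i))"
      using s2 summable_Suc_iff[of "\<lambda>i. a i / fact (P + i)"] by simp
    have "(\<Sum>i. a (Suc i) / fact (P + Suc i)) = - (a 0 / fact P)"
      using suminf_split_head[OF s3] z[OF that] by simp
    then have "(\<Sum>i. fact (Suc P) * (a (Suc i) / fact (P + Suc i))) = - (a 0 * real (Suc P))"
      unfolding suminf_mult[OF s2] by (simp del: of_nat_Suc)
    then have "\<bar>a 0\<bar> * real (Suc P) = norm (\<Sum>i. fact (Suc P) * (a (Suc i) / fact (P + Suc i)))"
      by (simp add: abs_mult)
    also have "\<dots> \<le> (\<Sum>i. norm (fact (Suc P) * (a (Suc i) / fact (P + Suc i))))"
      by (rule summable_norm[OF s1])
    also have "\<dots> \<le> D" unfolding D_def by (rule suminf_le[OF b s1 sD])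
    finally show ?thesis .
  qed
  show ?thesis
  proof (rule ccontr)
    assume "a 0 \<noteq> 0"
    then obtain k where k: "D < real k * \<bar>a 0\<bar>" using reals_Archimedean3[of "\<bar>a 0\<bar>"] by auto
    have "real k * \<bar>a 0\<bar> \<le> \<bar>a 0\<bar> * real (Suc (max k P0))"
      by (subst mult.commute, rule mult_left_mono) auto
    with dominated[of "max k P0"] k show False by simp
  qed
qed

text \<open>Strong induction on q: once the coefficients before q vanish, dropping them from the
  series for K leaves the tail series of the shifted sequence with P = K + 1 + q, whose leading
  coefficient is a q.\<close>

lemma exp_bounded_tails_eq_0:
  assumes "exp_bounded a" and "\<And>K. (\<Sum>j. a j / fact (Suc K + j)) = 0"
  shows "a q = 0"
proof (induction q rule: less_induct)
  case (less q)
  have eb: "exp_bounded (\<lambda>j. a (q + j))"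
    using assms(1) by (induction q) (auto dest: exp_bounded_shift)
  have "(\<Sum>j. a (q + j) / fact (P + j)) = 0" if "P \<ge> Suc q" for P
  proof -
    obtain K where P: "P = Suc K + q" using \<open>P \<ge> Suc q\<close> by (metis add.commute le_Suc_ex add_Suc_shift)
    have "summable (\<lambda>j. a j / fact (Suc K + j))"
    proof -
      \<comment> \<open>Padding with K + 1 zeros exhibits the series as an exponential generating
        function at 1, which gives its summability.\<close>
      have "exp_bounded (\<lambda>k. if k < Suc K then 0 else a (k - Suc K))"
      proof -
        obtain C M where "M \<ge> 0" and a: "\<And>k. \<bar>a k\<bar> \<le> C * M ^ k"
          using assms unfolding exp_bounded_def by blast
        have C: "C \<ge> 0" using a[of 0] by auto
        show ?thesis
        \<comment> \<open>The base must be at least 1 for its powers to grow from k - (K + 1) to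
          k.\<close>
        proof (rule exp_boundedI[of "max 1 M" _ C])
          fix k
          have "C * M ^ (k - Suc K) \<le> C * max 1 M ^ (k - Suc K)"
            using C \<open>M \<ge> 0\<close> by (intro mult_left_mono power_mono) auto
          also have "\<dots> \<le> C * max 1 M ^ k"
            using C by (intro mult_left_mono power_increasing) auto
          finally show "\<bar>if k < Suc K then 0 else a (k - Suc K)\<bar> \<le> C * max 1 M ^ k"
            using a[of "k - Suc K"] C by auto
        qed auto
      qed
      from egf_summable[OF this, of 1] have "summable (\<lambda>k. (if k < Suc K then 0 else a (k - Suc K)) / fact k)"
        by simp
      then have "summable (\<lambda>j. (if j + Suc K < Suc K then 0 else a (j + Suc K - Suc K)) / fact (j + Suc K))"
        by (subst summable_iff_shift)
      then show ?thesis by (simp add: add.commute)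
    qed
    from suminf_split_initial_segment[OF this, of q] assms(2)[of K] less
    show ?thesis unfolding P by (simp add: algebra_simps)
  qed
  from exp_bounded_tail_eq_0[OF eb this] show ?case by simp
qed

subsection \<open>A linear alternative\<close>

text \<open>Gaussian elimination of the last coordinate, by induction on p: either every member of S
  vanishes there, or a pivot e with e p \<noteq> 0 projects S onto its members that do. Closure
  under s + c t together with nonemptiness makes S a subspace.\<close>

lemma subspace_fills_or_annihilated:
  fixes S :: "(nat \<Rightarrow> real) set"
  assumes "\<And>s t c. s \<in> S \<Longrightarrow> t \<in> S \<Longrightarrow> (\<lambda>i. s i + c * t i) \<in> S" "S \<noteq> {}"
  shows "(\<forall>y. \<exists>s\<in>S. \<forall>i<p. s i = y i)
    \<or> (\<exists>\<xi>. (\<exists>i<p. \<xi> i \<noteq> 0) \<and> (\<forall>s\<in>S. (\<Sum>i<p. \<xi> i * s i) = 0))"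
  using assms
proof (induction p arbitrary: S)
  case 0
  then show ?case by auto
next
  case (Suc p)
  show ?case
  proof (cases "\<exists>s\<in>S. s p \<noteq> 0")
    case False
    then have "\<forall>s\<in>S. (\<Sum>i<Suc p. (if i = p then 1 else 0) * s i) = 0" by simp
    then show ?thesis by (intro disjI2 exI[of _ "\<lambda>i. if i = p then 1 else 0"]) auto
  next
    case True
    then obtain e where e: "e \<in> S" "e p \<noteq> 0" by blast
    define S' where "S' = {s \<in> S. s p = 0}"
    have proj: "(\<lambda>i. s i + (- s p / e p) * e i) \<in> S'" if "s \<in> S" for s
      using Suc.prems(1)[OF that e(1), of "- s p / e p"] e(2) by (simp add: S'_def)
    have "S' \<noteq> {}" using proj[OF e(1)] by blast
    moreover have "(\<lambda>i. s i + c * t i) \<in> S'" if "s \<in> S'" "t \<in> S'" for s t c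
      using that Suc.prems(1) by (simp add: S'_def)
    ultimately consider (fill) "\<forall>y. \<exists>s\<in>S'. \<forall>i<p. s i = y i"
      | (ann) \<xi> where "\<exists>i<p. \<xi> i \<noteq> 0" "\<forall>s\<in>S'. (\<Sum>i<p. \<xi> i * s i) = 0"
      using Suc.IH[of S'] by blast
    then show ?thesis
    proof cases
      case fill
      have "\<exists>s\<in>S. \<forall>i<Suc p. s i = y i" for y
      proof -
        \<comment> \<open>The contribution of the pivot is subtracted in advance: adding (y p / e p)
          e afterwards restores the first p coordinates and sets the last one, where s is 0.\<close>
        obtain s where s: "s \<in> S'" "\<forall>i<p. s i = y i - y p / e p * e i"
          using fill[rule_format, of "\<lambda>i. y i - y p / e p * e i"] by blast
        have "(\<lambda>i. s i + y p / e p * e i) \<in> S" using s(1) Suc.prems(1)[of s e "y p / e p"] e(1) by (simp add: S'_def)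
        moreover have "\<forall>i<Suc p. s i + y p / e p * e i = y i"
          using s e(2) by (auto simp: less_Suc_eq S'_def)
        ultimately show ?thesis by (intro bexI[of _ "\<lambda>i. s i + y p / e p * e i"])
      qed
      then show ?thesis by blast
    next
      case ann
      \<comment> \<open>The last coefficient is the one for which \<eta> also annihilates e. Every s
        is its projection plus a multiple of e, so \<eta> then annihilates all of S.\<close>
      define \<eta> where "\<eta> = \<xi>(p := - (\<Sum>i<p. \<xi> i * e i) / e p)"
      have "(\<Sum>i<Suc p. \<eta> i * s i) = 0" if "s \<in> S" for s
      proof -
        have "(\<Sum>i<p. \<xi> i * (s i + (- s p / e p) * e i)) = 0"
          by (rule bspec[OF ann(2) proj[OF that]])
        then have "(\<Sum>i<p. \<xi> i * s i) - s p / e p * (\<Sum>i<p. \<xi> i * e i) = 0"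
          by (simp add: sum_distrib_left algebra_simps sum_subtractf)
        moreover have "(\<Sum>i<p. \<eta> i * s i) = (\<Sum>i<p. \<xi> i * s i)"
          by (rule sum.cong) (auto simp: \<eta>_def)
        ultimately show ?thesis by (simp add: \<eta>_def algebra_simps)
      qed
      moreover have "\<exists>i<Suc p. \<eta> i \<noteq> 0" using ann(1) by (auto simp: \<eta>_def intro: less_SucI)
      ultimately show ?thesis by blast
    qed
  qed
qed

subsection \<open>Monotonicity with finitely many exceptional points\<close>

text \<open>The interval is split at one exceptional point after another; continuity of f there lets
  the inequalities on the two halves be chained.\<close>

lemma nondecreasing_if_deriv_nonneg_except_finite:
  fixes f :: "real \<Rightarrow> real"
  assumes "finite S" "a \<le> b" "continuous_on {a..b} f"
    and "\<And>t. t \<in> {a<..<b} - S \<Longrightarrow> \<exists>y. (f has_real_derivative y) (at t) \<and> y \<ge> 0"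
  shows "f a \<le> f b"
  using assms
proof (induction S arbitrary: a b rule: finite_induct)
  case empty
  then show ?case by (intro DERIV_nonneg_imp_increasing_open[of a b f]) auto
next
  case (insert s S)
  show ?case
  proof (cases "s \<in> {a..b}")
    case True
    have "f a \<le> f s"
      using True insert.prems by (intro insert.IH) (auto elim: continuous_on_subset)
    also have "\<dots> \<le> f b"
      using True insert.prems by (intro insert.IH) (auto elim: continuous_on_subset)
    finally show ?thesis .
  next
    case False
    then show ?thesis using insert.prems by (intro insert.IH) auto
  qed
qed

text \<open>Taylor's remainder estimate without integrals. The bound for z (j + 1) of order k is the
  derivative of the function g, the bound for z j of order k + 1, and both g and z j vanish at
  a.\<close>

lemma derivative_chain_bound:
  fixes z :: "nat \<Rightarrow> real \<Rightarrow> real"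
  assumes "finite S" and cont: "\<And>k. continuous_on {a..b} (z k)"
    and deriv: "\<And>k t. t \<in> {a..b} - S \<Longrightarrow> (z k has_real_derivative z (Suc k) t) (at t within {a..b})"
    and "\<And>k. z k a = 0" and bound: "\<And>k t. t \<in> {a..b} \<Longrightarrow> \<bar>z k t\<bar> \<le> C * M ^ k"
    and "t \<in> {a..b}"
  shows "\<bar>z j t\<bar> \<le> C * M ^ (j + k) * (t - a) ^ k / fact k"
  using \<open>t \<in> {a..b}\<close>
proof (induction k arbitrary: j t)
  case 0
  then show ?case using bound by simp
next
  case (Suc k)
  define g where "g s = C * M ^ (j + Suc k) * (s - a) ^ Suc k / fact (Suc k)" for s
  have g': "(g has_real_derivative C * M ^ (Suc j + k) * (s - a) ^ k / fact k) (at s)" for s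
    unfolding g_def
    by (rule derivative_eq_intros refl | simp add: divide_simps del: of_nat_Suc)+
  have cg: "continuous_on {a..t} g" unfolding g_def by (intro continuous_intros) auto
  have cz: "continuous_on {a..t} (z j)" using Suc.prems by (intro continuous_on_subset[OF cont]) auto
  have dz: "(z j has_real_derivative z (Suc j) s) (at s)" if "s \<in> {a<..<t} - S" for s
  proof -
    have "at s within {a..b} = at s" using that Suc.prems by (intro at_within_Icc_at) auto
    then show ?thesis using deriv[of s j] that Suc.prems by auto
  qed
  \<comment> \<open>The values c = 1 and c = -1 give the two halves of the absolute value; comparing
    by monotonicity tolerates the exceptional times in S.\<close>
  have "g a + c * z j a \<le> g t + c * z j t" if "\<bar>c\<bar> = 1" for c
  proof (rule nondecreasing_if_deriv_nonneg_except_finite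
      [OF \<open>finite S\<close>, where f = "\<lambda>s. g s + c * z j s"])
    show "a \<le> t" using Suc.prems by simp
    show "continuous_on {a..t} (\<lambda>s. g s + c * z j s)" by (intro continuous_intros cg cz)
    fix s assume s: "s \<in> {a<..<t} - S"
    have "\<bar>z (Suc j) s\<bar> \<le> C * M ^ (Suc j + k) * (s - a) ^ k / fact k"
      using s Suc.prems by (intro Suc.IH) auto
    moreover have "\<bar>c * z (Suc j) s\<bar> = \<bar>z (Suc j) s\<bar>" using that by (simp add: abs_mult)
    ultimately show "\<exists>y. ((\<lambda>s. g s + c * z j s) has_real_derivative y) (at s) \<and> y \<ge> 0"
      using DERIV_add[OF g'[of s] DERIV_cmult[OF dz[OF s], of c]] by (intro exI conjI) auto
  qed
  from this[of 1] this[of "-1"] show ?case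
    using assms(4)[of j] by (simp add: g_def del: fact_Suc power_Suc)
qed

text \<open>The Taylor bound of order k is the k-th term of a convergent exponential series, hence
  tends to 0.\<close>

lemma derivative_chain_vanishes:
  fixes z :: "nat \<Rightarrow> real \<Rightarrow> real"
  assumes "finite S" and "\<And>k. continuous_on {a..b} (z k)"
    and "\<And>k t. t \<in> {a..b} - S \<Longrightarrow> (z k has_real_derivative z (Suc k) t) (at t within {a..b})"
    and "\<And>k. z k a = 0" and "\<And>k t. t \<in> {a..b} \<Longrightarrow> \<bar>z k t\<bar> \<le> C * M ^ k"
    and "t \<in> {a..b}"
  shows "z 0 t = 0"
proof -
  have "(\<lambda>k. C * (M * (t - a)) ^ k / fact k) \<longlonglongrightarrow> 0"
    by (rule summable_LIMSEQ_zero[OF summable_power_over_fact])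
  moreover have "\<bar>z 0 t\<bar> \<le> C * (M * (t - a)) ^ k / fact k" for k
    using derivative_chain_bound[OF assms, of 0 k] by (simp add: power_mult_distrib mult.assoc)
  ultimately have "\<bar>z 0 t\<bar> \<le> 0" by (intro LIMSEQ_le_const) auto
  then show ?thesis by simp
qed

subsection \<open>The rank criterion for target controllability\<close>

text \<open>One estimate serves both recursions below: the costates, with D = 0, and the state
  derivatives, where D accounts for a bounded input.\<close>

lemma linear_recursion_exp_bounded:
  fixes y :: "nat \<Rightarrow> nat \<Rightarrow> real"
  assumes rec: "\<And>k i. i < N \<Longrightarrow> \<bar>y (Suc k) i\<bar> \<le> (\<Sum>j<N. \<bar>A i j\<bar> * \<bar>y k j\<bar>) + D" and "D \<ge> 0"
  shows "\<exists>C M. M \<ge> 0 \<and> (\<forall>k. \<forall>i<N. \<bar>y k i\<bar> \<le> C * M ^ k)"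
proof -
  define C where "C = D + (\<Sum>i<N. \<bar>y 0 i\<bar>)"
  \<comment> \<open>The sum of all entries dominates every row sum, and the extra 1 absorbs the
    inhomogeneity, since D \<le> C M^k.\<close>
  define M where "M = 1 + (\<Sum>i<N. \<Sum>j<N. \<bar>A i j\<bar>)"
  have "C \<ge> D" unfolding C_def by (simp add: sum_nonneg)
  have "M \<ge> 1" unfolding M_def by (simp add: sum_nonneg)
  have "\<bar>y k i\<bar> \<le> C * M ^ k" if "i < N" for k i
    using that
  proof (induction k arbitrary: i)
    case 0
    have "\<bar>y 0 i\<bar> \<le> (\<Sum>i<N. \<bar>y 0 i\<bar>)" using 0 by (intro member_le_sum) auto
    then show ?case using \<open>D \<ge> 0\<close> by (simp add: C_def)
  next
    case (Suc k)
    have "\<bar>y (Suc k) i\<bar> \<le> (\<Sum>j<N. \<bar>A i j\<bar> * (C * M ^ k)) + D"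
      by (intro order_trans[OF rec[OF Suc.prems]] add_right_mono sum_mono mult_left_mono Suc.IH) auto
    also have "\<dots> = (\<Sum>j<N. \<bar>A i j\<bar>) * (C * M ^ k) + D" by (simp add: sum_distrib_right)
    also have "\<dots> \<le> (M - 1) * (C * M ^ k) + C * M ^ k"
    proof (intro add_mono mult_right_mono)
      show "(\<Sum>j<N. \<bar>A i j\<bar>) \<le> M - 1" unfolding M_def
        using member_le_sum[of i "{..<N}" "\<lambda>i. \<Sum>j<N. \<bar>A i j\<bar>"] Suc.prems by (simp add: sum_nonneg)
      show "0 \<le> C * M ^ k" using \<open>C \<ge> D\<close> \<open>D \<ge> 0\<close> \<open>M \<ge> 1\<close> by auto
      show "D \<le> C * M ^ k"
        using mult_mono[of D C 1 "M ^ k"] \<open>C \<ge> D\<close> \<open>D \<ge> 0\<close> \<open>M \<ge> 1\<close> by simp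
    qed
    also have "\<dots> = C * M ^ Suc k" by (simp add: algebra_simps)
    finally show ?case .
  qed
  moreover have "M \<ge> 0" using \<open>M \<ge> 1\<close> by simp
  ultimately show ?thesis by blast
qed

section \<open>Jets, costates and the rank condition\<close>

lemma mult_mat_vec_index:
  "A \<in> carrier_mat a b \<Longrightarrow> x \<in> carrier_vec b \<Longrightarrow> i < a \<Longrightarrow> (A *\<^sub>v x) $ i = (\<Sum>j<b. A $$ (i, j) * x $ j)"
  by (simp add: scalar_prod_def lessThan_atLeast0)

text \<open>The successive derivatives at the initial time of the solution of \<open>x' = F x + G u\<close>,
  where \<open>u k\<close> are those of the input.\<close>

primrec state_jet ::
  "real mat \<Rightarrow> real mat \<Rightarrow> (nat \<Rightarrow> nat \<Rightarrow> real) \<Rightarrow> (nat \<Rightarrow> real) \<Rightarrow> nat \<Rightarrow> nat \<Rightarrow> real" where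
  "state_jet F G u x 0 = x"
| "state_jet F G u x (Suc k) = (\<lambda>i. (\<Sum>j<dim_col F. F $$ (i, j) * state_jet F G u x k j)
     + (\<Sum>j<dim_col G. G $$ (i, j) * u k j))"

text \<open>The row c F^k, kept as a function of its column index so that all computations are with
  finite real sums.\<close>

primrec costate :: "real mat \<Rightarrow> (nat \<Rightarrow> real) \<Rightarrow> nat \<Rightarrow> nat \<Rightarrow> real" where
  "costate F c 0 = c"
| "costate F c (Suc k) = (\<lambda>j. \<Sum>i<dim_row F. costate F c k i * F $$ (i, j))"

text \<open>The row \<xi> J, from which the costates of an output functional start.\<close>

abbreviation pullback :: "real mat \<Rightarrow> (nat \<Rightarrow> real) \<Rightarrow> nat \<Rightarrow> real" where
  "pullback J \<xi> \<equiv> (\<lambda>i. \<Sum>a<dim_row J. \<xi> a * J $$ (a, i))"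

text \<open>The rows of the infinite matrix \<open>[J G, J F G, J F\<^sup>2 G, \<dots>]\<close> are linearly independent;
  by the Cayley-Hamilton theorem this is the usual rank condition.\<close>

definition output_rank_condition :: "real mat \<Rightarrow> real mat \<Rightarrow> real mat \<Rightarrow> bool" where
  "output_rank_condition F G J \<longleftrightarrow>
     (\<forall>\<xi>. (\<forall>k. \<forall>j<dim_col G. (\<Sum>i<dim_row F. costate F (pullback J \<xi>) k i * G $$ (i, j)) = 0)
        \<longrightarrow> (\<forall>a<dim_row J. \<xi> a = 0))"

lemma state_jet_add:
  "state_jet F G (\<lambda>k j. u k j + c * v k j) (\<lambda>i. x i + c * y i) k
     = (\<lambda>i. state_jet F G u x k i + c * state_jet F G v y k i)"
  by (induction k) (simp_all add: fun_eq_iff sum.distrib sum_distrib_left algebra_simps)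

lemma costate_exp_bounded:
  assumes "F \<in> carrier_mat N N"
  shows "\<exists>C M. M \<ge> 0 \<and> (\<forall>k. \<forall>i<N. \<bar>costate F c k i\<bar> \<le> C * M ^ k)"
proof (rule linear_recursion_exp_bounded)
  fix k j assume "j < N"
  have "\<bar>costate F c (Suc k) j\<bar> \<le> (\<Sum>i<N. \<bar>costate F c k i * F $$ (i, j)\<bar>)"
    using assms by (simp add: sum_abs)
  then show "\<bar>costate F c (Suc k) j\<bar> \<le> (\<Sum>i<N. \<bar>F $$ (i, j)\<bar> * \<bar>costate F c k i\<bar>) + 0"
    by (simp add: abs_mult mult.commute)
qed auto

lemma state_jet_exp_bounded:
  assumes F: "F \<in> carrier_mat N N" and u: "\<And>k j. \<bar>u k j\<bar> \<le> B" and "i < N"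
  shows "exp_bounded (\<lambda>k. state_jet F G u x k i)"
proof -
  have "B \<ge> 0" using u[of 0 0] by simp
  define D where "D = (\<Sum>i<N. \<Sum>j<dim_col G. \<bar>G $$ (i, j)\<bar> * B)"
  have "D \<ge> 0" unfolding D_def using \<open>B \<ge> 0\<close> by (intro sum_nonneg) auto
  have "\<bar>state_jet F G u x (Suc k) i\<bar> \<le> (\<Sum>j<N. \<bar>F $$ (i, j)\<bar> * \<bar>state_jet F G u x k j\<bar>) + D"
    if "i < N" for k i
  proof -
    have "\<bar>\<Sum>j<N. F $$ (i, j) * state_jet F G u x k j\<bar>
        \<le> (\<Sum>j<N. \<bar>F $$ (i, j)\<bar> * \<bar>state_jet F G u x k j\<bar>)"
      by (rule order_trans[OF sum_abs]) (simp add: abs_mult)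
    moreover have "\<bar>\<Sum>j<dim_col G. G $$ (i, j) * u k j\<bar> \<le> (\<Sum>j<dim_col G. \<bar>G $$ (i, j)\<bar> * B)"
      by (rule order_trans[OF sum_abs]) (auto simp: abs_mult intro!: sum_mono mult_left_mono u)
    moreover have "\<dots> \<le> D" unfolding D_def using \<open>B \<ge> 0\<close> that
      by (intro member_le_sum[of i "{..<N}" "\<lambda>i. \<Sum>j<dim_col G. \<bar>G $$ (i, j)\<bar> * B"] sum_nonneg) auto
    ultimately show ?thesis using F by simp
  qed
  from linear_recursion_exp_bounded[of N "state_jet F G u x" "\<lambda>i j. F $$ (i, j)" D, OF this \<open>D \<ge> 0\<close>]
  obtain C M where "M \<ge> 0" "\<And>k i. i < N \<Longrightarrow> \<bar>state_jet F G u x k i\<bar> \<le> C * M ^ k"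
    by blast
  then show ?thesis using \<open>i < N\<close> by (intro exp_boundedI) auto
qed

text \<open>One factor F moves from the state to the row by exchanging sums; the input then enters
  only through c F^q G, which is a Markov parameter when c is a row \<xi> J.\<close>

lemma costate_dot_state_jet_Suc:
  assumes "F \<in> carrier_mat N N"
  shows "(\<Sum>i<N. costate F c q i * state_jet F G u x (Suc k) i)
    = (\<Sum>i<N. costate F c (Suc q) i * state_jet F G u x k i)
      + (\<Sum>j<dim_col G. (\<Sum>i<N. costate F c q i * G $$ (i, j)) * u k j)"
proof -
  have "(\<Sum>i<N. costate F c q i * (\<Sum>j<N. F $$ (i, j) * state_jet F G u x k j))
      = (\<Sum>j<N. \<Sum>i<N. costate F c q i * (F $$ (i, j) * state_jet F G u x k j))"
    by (subst sum.swap) (simp add: sum_distrib_left)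
  moreover have "(\<Sum>i<N. costate F c q i * (\<Sum>j<dim_col G. G $$ (i, j) * u k j))
      = (\<Sum>j<dim_col G. \<Sum>i<N. costate F c q i * (G $$ (i, j) * u k j))"
    by (subst sum.swap) (simp add: sum_distrib_left)
  ultimately show ?thesis
    using assms by (simp add: distrib_left sum.distrib sum_distrib_right mult.assoc)
qed

section \<open>Necessity of the rank condition\<close>

lemma target_controllable_imp_output_rank:
  assumes F: "F \<in> carrier_mat N N" and G: "G \<in> carrier_mat N r" and J: "J \<in> carrier_mat p N"
    and "target_controllable F G J"
  shows "output_rank_condition F G J"
  unfolding output_rank_condition_def
proof (intro allI impI)
  fix \<xi> :: "nat \<Rightarrow> real" and a
  assume "\<forall>k. \<forall>j<dim_col G. (\<Sum>i<dim_row F. costate F (pullback J \<xi>) k i * G $$ (i, j)) = 0"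
    and a: "a < dim_row J"
  define c where "c = costate F (pullback J \<xi>)"
  have ann: "(\<Sum>i<N. c k i * G $$ (i, j)) = 0" if "j < r" for k j
    using \<open>\<forall>k. \<forall>j<dim_col G. _\<close> that F G by (simp add: c_def)
  \<comment> \<open>Starting from rest and demanding \<xi> itself as the output makes the final
    pairing equal to the sum of the squares of \<xi>.\<close>
  have "0\<^sub>v N \<in> carrier_vec (dim_row F)" "vec p \<xi> \<in> carrier_vec (dim_row J)" using F J by auto
  then obtain tf u x where "tf > 0" and u: "admissible_input (dim_col G) 0 tf u"
    and x: "state_trajectory F G 0 tf u x" and x0: "x 0 = 0\<^sub>v N" and yf: "J *\<^sub>v x tf = vec p \<xi>"
    using assms(4) unfolding target_controllable_def by blast
  have xc: "x t \<in> carrier_vec N" if "t \<in> {0..tf}" for t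
    using x that F unfolding state_trajectory_def by auto
  have uc: "u t \<in> carrier_vec r" if "t \<in> {0..tf}" for t
    using u that G unfolding admissible_input_def by auto
  have cont: "continuous_on {0..tf} (\<lambda>t. x t $ i)" if "i < N" for i
    using x that F unfolding state_trajectory_def by auto
  obtain S where "finite S" and deriv: "\<And>t i. t \<in> {0..tf} - S \<Longrightarrow> i < N \<Longrightarrow>
      ((\<lambda>s. x s $ i) has_real_derivative (F *\<^sub>v x t + G *\<^sub>v u t) $ i) (at t within {0..tf})"
    using x F unfolding state_trajectory_def by auto
  define z where "z k t = (\<Sum>i<N. c k i * x t $ i)" for k t
  have zc: "continuous_on {0..tf} (z k)" for k
    unfolding z_def by (intro continuous_intros cont) auto
  have zd: "(z k has_real_derivative z (Suc k) t) (at t within {0..tf})" if t: "t \<in> {0..tf} - S" for k t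
  proof -
    have "(\<Sum>i<N. c k i * (F *\<^sub>v x t + G *\<^sub>v u t) $ i)
        = (\<Sum>i<N. c k i * ((\<Sum>j<N. F $$ (i, j) * x t $ j) + (\<Sum>j<r. G $$ (i, j) * u t $ j)))"
    proof (intro sum.cong refl arg_cong2[where f = "(*)"])
      fix i assume "i \<in> {..<N}"
      then show "(F *\<^sub>v x t + G *\<^sub>v u t) $ i
          = (\<Sum>j<N. F $$ (i, j) * x t $ j) + (\<Sum>j<r. G $$ (i, j) * u t $ j)"
        using mult_mat_vec_index[OF F xc] mult_mat_vec_index[OF G uc] t F G by simp
    qed
    also have "\<dots> = (\<Sum>i<N. \<Sum>j<N. c k i * (F $$ (i, j) * x t $ j))
        + (\<Sum>i<N. \<Sum>j<r. c k i * (G $$ (i, j) * u t $ j))"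
      by (simp add: distrib_left sum.distrib sum_distrib_left)
    also have "(\<Sum>i<N. \<Sum>j<r. c k i * (G $$ (i, j) * u t $ j))
        = (\<Sum>j<r. (\<Sum>i<N. c k i * G $$ (i, j)) * u t $ j)"
      by (subst sum.swap) (simp add: sum_distrib_right mult.assoc)
    also have "\<dots> = 0" by (simp add: ann)
    also have "(\<Sum>i<N. \<Sum>j<N. c k i * (F $$ (i, j) * x t $ j)) = z (Suc k) t"
      using F by (subst sum.swap) (simp add: z_def c_def sum_distrib_right mult.assoc)
    finally have "(\<Sum>i<N. c k i * (F *\<^sub>v x t + G *\<^sub>v u t) $ i) = z (Suc k) t" by simp
    moreover have "(z k has_real_derivative (\<Sum>i<N. c k i * (F *\<^sub>v x t + G *\<^sub>v u t) $ i)) (at t within {0..tf})"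
      unfolding z_def using deriv[OF t] by (intro DERIV_sum DERIV_cmult) auto
    ultimately show ?thesis by simp
  qed
  obtain C M where M: "M \<ge> 0" "\<And>k i. i < N \<Longrightarrow> \<bar>c k i\<bar> \<le> C * M ^ k"
    using costate_exp_bounded[OF F, of "pullback J \<xi>"] unfolding c_def by blast
  \<comment> \<open>Compactness bounds the state on the whole interval, so the growth bound of the
    costates passes to \<open>z\<close>, uniformly in time.\<close>
  have "continuous_on {0..tf} (\<lambda>t. \<Sum>i<N. \<bar>x t $ i\<bar>)"
    by (intro continuous_intros cont) auto
  then have "\<exists>s\<in>{0..tf}. \<forall>t\<in>{0..tf}. (\<Sum>i<N. \<bar>x t $ i\<bar>) \<le> (\<Sum>i<N. \<bar>x s $ i\<bar>)"
    using \<open>tf > 0\<close> by (intro continuous_attains_sup compact_Icc) auto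
  then obtain X where X: "\<And>t. t \<in> {0..tf} \<Longrightarrow> (\<Sum>i<N. \<bar>x t $ i\<bar>) \<le> X" by blast
  have zb: "\<bar>z k t\<bar> \<le> (\<bar>C\<bar> * X) * M ^ k" if "t \<in> {0..tf}" for k t
  proof -
    have "\<bar>z k t\<bar> \<le> (\<Sum>i<N. \<bar>c k i\<bar> * \<bar>x t $ i\<bar>)"
      unfolding z_def by (rule order_trans[OF sum_abs]) (simp add: abs_mult)
    also have "\<dots> \<le> (\<Sum>i<N. (\<bar>C\<bar> * M ^ k) * \<bar>x t $ i\<bar>)"
    proof (intro sum_mono mult_right_mono)
      fix i assume "i \<in> {..<N}"
      then show "\<bar>c k i\<bar> \<le> \<bar>C\<bar> * M ^ k"
        using M(2)[of i k] mult_right_mono[OF abs_ge_self[of C], of "M ^ k"] M(1)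
        by (auto intro: order_trans)
    qed auto
    also have "\<dots> = (\<bar>C\<bar> * M ^ k) * (\<Sum>i<N. \<bar>x t $ i\<bar>)" by (simp add: sum_distrib_left)
    also have "\<dots> \<le> (\<bar>C\<bar> * M ^ k) * X" using X[OF that] M(1) by (intro mult_left_mono) auto
    finally show ?thesis by (simp add: mult_ac)
  qed
  have "z 0 tf = 0"
    using \<open>tf > 0\<close> by (intro derivative_chain_vanishes[OF \<open>finite S\<close> zc zd _ zb]) (auto simp: z_def x0)
  moreover have "z 0 tf = (\<Sum>a<p. \<xi> a * (J *\<^sub>v x tf) $ a)"
  proof -
    have "z 0 tf = (\<Sum>i<N. \<Sum>a<p. \<xi> a * J $$ (a, i) * x tf $ i)"
      using J by (simp add: z_def c_def sum_distrib_right)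
    also have "\<dots> = (\<Sum>a<p. \<xi> a * (\<Sum>i<N. J $$ (a, i) * x tf $ i))"
      by (subst sum.swap) (simp add: sum_distrib_left mult.assoc)
    also have "\<dots> = (\<Sum>a<p. \<xi> a * (J *\<^sub>v x tf) $ a)"
      using mult_mat_vec_index[OF J xc[of tf]] \<open>tf > 0\<close> by (intro sum.cong) auto
    finally show ?thesis .
  qed
  ultimately have "(\<Sum>a<p. \<xi> a * \<xi> a) = 0" by (simp add: yf)
  then show "\<xi> a = 0" using a J by (subst (asm) sum_nonneg_eq_0_iff) auto
qed

section \<open>Sufficiency of the rank condition by power series inputs\<close>

lemma series_trajectory:
  fixes t0 tf :: real and x :: "nat \<Rightarrow> real"
  assumes F: "F \<in> carrier_mat N N" and G: "G \<in> carrier_mat N r" and u: "\<And>k j. \<bar>u k j\<bar> \<le> B"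
  defines "U \<equiv> \<lambda>t. vec r (\<lambda>j. egf (\<lambda>k. u k j) (t - t0))"
    and "X \<equiv> \<lambda>t. vec N (\<lambda>i. egf (\<lambda>k. state_jet F G u x k i) (t - t0))"
  shows "admissible_input r t0 tf U" and "state_trajectory F G t0 tf U X"
proof -
  have ub: "exp_bounded (\<lambda>k. u k j)" for j
    using u by (intro exp_boundedI[of 1 _ B]) auto
  note xb = state_jet_exp_bounded[where u = u, OF F u]
  have d: "((\<lambda>t. egf a (t - t0)) has_real_derivative egf (\<lambda>k. a (Suc k)) (t - t0)) (at t within A)"
    if "exp_bounded a" for a t A
    using DERIV_chain2[OF egf_has_derivative[OF that], of "\<lambda>t. t - t0" 1 t A]
    by (simp add: DERIV_diff[of "\<lambda>t. t" 1 _ _ "\<lambda>t. t0" 0, simplified])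
  have c: "continuous_on A (\<lambda>t. egf a (t - t0))" if "exp_bounded a" for a A
    unfolding continuous_on_eq_continuous_within using d[OF that] by (blast intro: DERIV_continuous)
  have pc: "piecewise_continuous t0 tf (\<lambda>t. egf a (t - t0))" if "exp_bounded a" for a
  proof -
    have "((\<lambda>t. egf a (t - t0)) \<longlongrightarrow> egf a (s - t0)) (at s within A)" for s A
      using c[OF that, of UNIV] by (auto simp: continuous_on_def intro: tendsto_within_subset)
    then show ?thesis
      unfolding piecewise_continuous_def using c[OF that] by (blast intro: finite.emptyI)
  qed
  show "admissible_input r t0 tf U"
    unfolding admissible_input_def U_def using pc[OF ub] by simp
  show "state_trajectory F G t0 tf U X"
    unfolding state_trajectory_def
  \<comment> \<open>The input has no jumps, so the set of exceptional times is empty.\<close>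
  proof (intro conjI exI[of _ "{}"] ballI allI impI)
    fix i assume "i < dim_row F"
    then have i: "i < N" using F by simp
    show "continuous_on {t0..tf} (\<lambda>t. X t $ i)" using c[OF xb[OF i]] i by (simp add: X_def)
    fix t
    have "(F *\<^sub>v X t + G *\<^sub>v U t) $ i
        = (\<Sum>j<N. F $$ (i, j) * X t $ j) + (\<Sum>j<r. G $$ (i, j) * U t $ j)"
      using mult_mat_vec_index[OF F, of "X t" i] mult_mat_vec_index[OF G, of "U t" i] i F G
      by (simp add: X_def U_def)
    also have "\<dots> = egf (\<lambda>k. \<Sum>j<N. F $$ (i, j) * state_jet F G u x k j) (t - t0)
        + egf (\<lambda>k. \<Sum>j<r. G $$ (i, j) * u k j) (t - t0)"
      using egf_linear_combination[of "{..<N}" "\<lambda>j k. state_jet F G u x k j" "\<lambda>j. F $$ (i, j)"]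
        egf_linear_combination[of "{..<r}" "\<lambda>j k. u k j" "\<lambda>j. G $$ (i, j)"] ub xb
      by (simp add: X_def U_def)
    \<comment> \<open>The recursion of \<open>state_jet\<close> is the differential equation read
      coefficient by coefficient.\<close>
    also have "\<dots> = egf (\<lambda>k. state_jet F G u x (Suc k) i) (t - t0)"
      using F G ub xb
      by (subst egf_add[symmetric]) (auto intro!: exp_bounded_sum exp_bounded_cmult)
    finally show "((\<lambda>s. X s $ i) has_real_derivative (F *\<^sub>v X t + G *\<^sub>v U t) $ i) (at t within {t0..tf})"
      using d[OF xb[OF i]] i by (simp add: X_def)
  qed (use F in \<open>auto simp: X_def\<close>)
qed

text \<open>With an input that is an impulse among the jets, the output pairs with \<open>\<xi>\<close> to a tail
  series of the Markov parameters; these series all vanish only if the parameters do.\<close>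

lemma annihilates_series_outputs_imp_markov_0:
  assumes F: "F \<in> carrier_mat N N" and G: "G \<in> carrier_mat N r" and J: "J \<in> carrier_mat p N"
    and ann: "\<And>u B. (\<And>k j. \<bar>u k j\<bar> \<le> B) \<Longrightarrow>
      (\<Sum>a<p. \<xi> a * (\<Sum>i<N. J $$ (a, i) * egf (\<lambda>k. state_jet F G u (\<lambda>_. 0) k i) 1)) = 0"
    and "l < r"
  shows "(\<Sum>i<N. costate F (pullback J \<xi>) q i * G $$ (i, l)) = 0"
proof -
  define c where "c = costate F (pullback J \<xi>)"
  define a where "a q = (\<Sum>i<N. c q i * G $$ (i, l))" for q
  obtain C M where M: "M \<ge> 0" "\<And>k i. i < N \<Longrightarrow> \<bar>c k i\<bar> \<le> C * M ^ k"
    using costate_exp_bounded[OF F, of "pullback J \<xi>"] unfolding c_def by blast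
  then have "exp_bounded (\<lambda>k. c k i)" if "i < N" for i using that by (intro exp_boundedI) auto
  then have "exp_bounded a"
    unfolding a_def by (subst mult.commute) (auto intro!: exp_bounded_sum exp_bounded_cmult)
  moreover have "(\<Sum>j. a j / fact (Suc K + j)) = 0" for K
  proof -
    \<comment> \<open>The derivatives at the initial time of the input t^K / K! in component
      l.\<close>
    define u where "u k j = (if k = K \<and> j = l then 1 else 0 :: real)" for k j
    have u: "\<bar>u k j\<bar> \<le> 1" for k j by (simp add: u_def)
    note xb = state_jet_exp_bounded[where u = u, OF F u]
    define s where "s = state_jet F G u (\<lambda>_. 0)"
    have s_Suc: "(\<Sum>i<N. c q i * s (Suc k) i)
        = (\<Sum>i<N. c (Suc q) i * s k i) + (if k = K then a q else 0)" for q k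
    proof -
      have "(\<Sum>j<r. (\<Sum>i<N. c q i * G $$ (i, j)) * u k j) = (if k = K then a q else 0)"
        using \<open>l < r\<close> by (simp add: u_def a_def if_distrib cong: if_cong)
      then show ?thesis
        using costate_dot_state_jet_Suc[OF F, of "pullback J \<xi>" q G u "\<lambda>_. 0" k] G
        by (simp add: c_def s_def del: costate.simps state_jet.simps)
    qed
    \<comment> \<open>The input reaches the state at order K + 1, where it pairs to a q; each
      further order moves one more F to the row and so raises the index of \<open>a\<close> by
      one.\<close>
    have before: "(\<Sum>i<N. c q i * s k i) = 0" if "k < Suc K" for q k
      using that by (induction k arbitrary: q) (simp add: s_def, simp add: s_Suc)
    have after: "(\<Sum>i<N. c q i * s (Suc K + j) i) = a (q + j)" for q j
      by (induction j arbitrary: q) (simp_all add: s_Suc before)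
    have "0 = (\<Sum>a<p. \<xi> a * (\<Sum>i<N. J $$ (a, i) * egf (\<lambda>k. s k i) 1))"
      using ann[OF u] by (simp add: s_def)
    also have "\<dots> = (\<Sum>i<N. c 0 i * egf (\<lambda>k. s k i) 1)"
    proof -
      have "(\<Sum>a<p. \<xi> a * (\<Sum>i<N. J $$ (a, i) * egf (\<lambda>k. s k i) 1))
          = (\<Sum>i<N. \<Sum>a<p. \<xi> a * (J $$ (a, i) * egf (\<lambda>k. s k i) 1))"
        by (subst sum.swap) (simp add: sum_distrib_left)
      then show ?thesis using J by (simp add: c_def sum_distrib_right mult.assoc)
    qed
    also have "\<dots> = egf (\<lambda>k. \<Sum>i<N. c 0 i * s k i) 1"
      using egf_linear_combination[of "{..<N}" "\<lambda>i k. s k i" "c 0" 1] xb by (simp add: s_def)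
    also have "\<dots> = (\<Sum>j. a j / fact (Suc K + j))"
    proof (subst egf_shift_eq[of _ "Suc K"])
      show "exp_bounded (\<lambda>k. \<Sum>i<N. c 0 i * s k i)"
        using xb by (auto simp: s_def intro!: exp_bounded_sum exp_bounded_cmult)
      show "(\<Sum>i<N. c 0 i * s k i) = 0" if "k < Suc K" for k by (rule before[OF that])
      show "(\<Sum>i. (\<Sum>ia<N. c 0 ia * s (Suc K + i) ia) / fact (Suc K + i)) = (\<Sum>j. a j / fact (Suc K + j))"
        by (simp only: after add_0)
    qed
    finally show ?thesis by simp
  qed
  ultimately have "a q = 0" by (rule exp_bounded_tails_eq_0)
  then show ?thesis by (simp add: a_def c_def)
qed

lemma output_rank_imp_target_controllable:
  assumes F: "F \<in> carrier_mat N N" and G: "G \<in> carrier_mat N r" and J: "J \<in> carrier_mat p N"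
    and rank: "output_rank_condition F G J"
  shows "target_controllable F G J"
proof -
  define out where "out u x a = (\<Sum>i<N. J $$ (a, i) * egf (\<lambda>k. state_jet F G u x k i) 1)" for u x a
  have out_add: "out (\<lambda>k j. u k j + c * v k j) (\<lambda>i. x i + c * y i) = (\<lambda>a. out u x a + c * out v y a)"
    if u: "\<And>k j. \<bar>u k j\<bar> \<le> B" and v: "\<And>k j. \<bar>v k j\<bar> \<le> D" for u v x y c B D
    using state_jet_exp_bounded[where u = u, OF F u] state_jet_exp_bounded[where u = v, OF F v]
    by (simp add: out_def fun_eq_iff state_jet_add egf_add egf_cmult exp_bounded_cmult
        sum.distrib sum_distrib_left algebra_simps)
  \<comment> \<open>The outputs reached from rest in unit time by inputs with bounded derivatives at
    the initial time.\<close>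
  define S where "S = {out u (\<lambda>_. 0) | u. \<exists>B. \<forall>k j. \<bar>u k j\<bar> \<le> B}"
  have "(\<lambda>i. s i + c * t i) \<in> S" if "s \<in> S" "t \<in> S" for s t c
  proof -
    obtain u B where s: "s = out u (\<lambda>_. 0)" and u: "\<And>k j. \<bar>u k j\<bar> \<le> B"
      using \<open>s \<in> S\<close> unfolding S_def by auto
    obtain v D where t: "t = out v (\<lambda>_. 0)" and v: "\<And>k j. \<bar>v k j\<bar> \<le> D"
      using \<open>t \<in> S\<close> unfolding S_def by auto
    have "\<bar>u k j + c * v k j\<bar> \<le> B + \<bar>c\<bar> * D" for k j
      using u[of k j] mult_left_mono[OF v[of k j], of "\<bar>c\<bar>"] abs_triangle_ineq[of "u k j" "c * v k j"]
      by (simp add: abs_mult)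
    then have "\<exists>B. \<forall>k j. \<bar>u k j + c * v k j\<bar> \<le> B" by blast
    moreover have "(\<lambda>i. s i + c * t i) = out (\<lambda>k j. u k j + c * v k j) (\<lambda>_. 0)"
      using out_add[where u = u and v = v, OF u v, where c = c and x = "\<lambda>_. 0" and y = "\<lambda>_. 0"] unfolding s t by simp
    ultimately show ?thesis unfolding S_def by blast
  qed
  moreover have "S \<noteq> {}"
    unfolding S_def by (auto intro!: exI[of _ "\<lambda>_ _. 0"])
  ultimately have "(\<forall>y. \<exists>s\<in>S. \<forall>i<p. s i = y i)
      \<or> (\<exists>\<xi>. (\<exists>i<p. \<xi> i \<noteq> 0) \<and> (\<forall>s\<in>S. (\<Sum>i<p. \<xi> i * s i) = 0))"
    by (rule subspace_fills_or_annihilated)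
  moreover have "\<not> (\<exists>i<p. \<xi> i \<noteq> 0)" if \<xi>: "\<forall>s\<in>S. (\<Sum>i<p. \<xi> i * s i) = 0" for \<xi>
  proof -
    have "(\<Sum>i<N. costate F (pullback J \<xi>) q i * G $$ (i, l)) = 0" if "l < r" for q l
    proof (rule annihilates_series_outputs_imp_markov_0[OF F G J _ that])
      fix u :: "nat \<Rightarrow> nat \<Rightarrow> real" and B assume "\<And>k j. \<bar>u k j\<bar> \<le> B"
      then have "out u (\<lambda>_. 0) \<in> S" unfolding S_def by blast
      from bspec[OF \<xi> this] show "(\<Sum>a<p. \<xi> a * (\<Sum>i<N. J $$ (a, i) * egf (\<lambda>k. state_jet F G u (\<lambda>_. 0) k i) 1)) = 0"
        by (simp add: out_def)
    qed
    then show ?thesis using rank F G J unfolding output_rank_condition_def by auto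
  qed
  ultimately have fill: "\<exists>s\<in>S. \<forall>i<p. s i = y i" for y by blast
  show ?thesis
    unfolding target_controllable_def
  proof (intro allI ballI)
    fix t0 :: real and x0 yf :: "real vec"
    assume "x0 \<in> carrier_vec (dim_row F)" "yf \<in> carrier_vec (dim_row J)"
    then have x0: "x0 \<in> carrier_vec N" and yf: "yf \<in> carrier_vec p" using F J by auto
    \<comment> \<open>By superposition it is enough to reach, from rest, the target minus the free
      response of the initial state.\<close>
    obtain u B where u: "\<And>k j. \<bar>u k j\<bar> \<le> B"
      and out_u: "\<And>a. a < p \<Longrightarrow> out u (\<lambda>_. 0) a = yf $ a - out (\<lambda>_ _. 0) (\<lambda>i. x0 $ i) a"
      using fill[of "\<lambda>a. yf $ a - out (\<lambda>_ _. 0) (\<lambda>i. x0 $ i) a"] unfolding S_def by auto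
    define U where "U = (\<lambda>t. vec r (\<lambda>j. egf (\<lambda>k. u k j) (t - t0)))"
    define X where "X = (\<lambda>t. vec N (\<lambda>i. egf (\<lambda>k. state_jet F G u (\<lambda>i. x0 $ i) k i) (t - t0)))"
    have "admissible_input (dim_col G) t0 (t0 + 1) U" "state_trajectory F G t0 (t0 + 1) U X"
      using series_trajectory[OF F G u, of t0 "t0 + 1"] G unfolding U_def X_def by auto
    moreover have "X t0 = x0" using x0 by (intro eq_vecI) (auto simp: X_def)
    moreover have "J *\<^sub>v X (t0 + 1) = yf"
    proof (rule eq_vecI)
      fix a assume "a < dim_vec yf"
      then have a: "a < p" using yf by simp
      have "X (t0 + 1) \<in> carrier_vec N" by (simp add: X_def)
      from mult_mat_vec_index[OF J this a]
      have "(J *\<^sub>v X (t0 + 1)) $ a = out u (\<lambda>i. x0 $ i) a" by (simp add: out_def X_def)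
      also have "\<dots> = out (\<lambda>_ _. 0) (\<lambda>i. x0 $ i) a + out u (\<lambda>_. 0) a"
        using out_add[where u = "\<lambda>_ _. 0" and B = 0 and v = u and D = B and c = 1
            and x = "\<lambda>i. x0 $ i" and y = "\<lambda>_. 0"] u by (simp add: fun_eq_iff)
      also have "\<dots> = yf $ a" using out_u[OF a] by simp
      finally show "(J *\<^sub>v X (t0 + 1)) $ a = yf $ a" .
    qed (use J yf in auto)
    ultimately show "\<exists>tf>t0. \<exists>u x. admissible_input (dim_col G) t0 tf u \<and>
        state_trajectory F G t0 tf u x \<and> x t0 = x0 \<and> J *\<^sub>v x tf = yf"
      by (intro exI[of _ "t0 + 1"] conjI exI[of _ U] exI[of _ X]) auto
  qed
qed

theorem target_controllable_iff_output_rank: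
  assumes "F \<in> carrier_mat N N" "G \<in> carrier_mat N r" "J \<in> carrier_mat p N"
  shows "target_controllable F G J \<longleftrightarrow> output_rank_condition F G J"
  using target_controllable_imp_output_rank[OF assms] output_rank_imp_target_controllable[OF assms]
  by blast

subsection \<open>Markov parameters of the high-order system\<close>

text \<open>The map taking i to s n + i is a bijection onto block s. It collapses sums over all n m
  coordinates when the summand is supported in one block.\<close>

lemma sum_block:
  fixes f :: "nat \<Rightarrow> real"
  assumes "s < m"
  shows "(\<Sum>i<n * m. if i div n = s then f (i mod n) else 0) = (\<Sum>i<n. f i)"
proof -
  have "(\<Sum>i<n. f i) = (\<Sum>i | i < n * m \<and> i div n = s. f (i mod n))"
  proof (rule sum.reindex_bij_witness[of _ "\<lambda>i. i mod n" "\<lambda>i. s * n + i"])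
    fix i assume i: "i \<in> {..<n}"
    have "s * n + i < Suc s * n" using i by simp
    also have "\<dots> \<le> m * n" using assms by (intro mult_right_mono) auto
    finally show "s * n + i \<in> {i. i < n * m \<and> i div n = s}" using i by (simp add: mult.commute)
  next
    fix i assume i: "i \<in> {i. i < n * m \<and> i div n = s}"
    then have "n > 0" by (cases n) auto
    then show "i mod n \<in> {..<n}" by simp
    show "s * n + i mod n = i" using i div_mult_mod_eq[of i n] by simp
  qed auto
  also have "\<dots> = (\<Sum>i<n * m. if i div n = s then f (i mod n) else 0)"
    by (rule sum.mono_neutral_cong_left) auto
  finally show ?thesis by simp
qed

text \<open>The transposed state matrix shifts a block down and applies \<open>- L\<^sup>T\<close> when it wraps around.\<close>

lemma costate_high_order:
  assumes L: "L \<in> carrier_mat n n" and H: "H \<in> carrier_mat p n" and "m \<ge> 1" and "i < n * m"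
  shows "costate (high_order_state_mat m L) (pullback (high_order_output_mat m H) \<xi>) k i
    = (if i div n = k mod m then costate (- L) (pullback H \<xi>) (k div m) (i mod n) else 0)"
  using \<open>i < n * m\<close>
proof (induction k arbitrary: i)
  case 0
  then have "n > 0" by (cases n) auto
  then show ?case using 0 H by (auto simp: high_order_output_mat_def Let_def)
next
  case (Suc k)
  then have "n > 0" by (cases n) auto
  define d where "d = costate (- L) (pullback H \<xi>)"
  define A where "A = high_order_state_mat m L"
  have A: "A \<in> carrier_mat (n * m) (n * m)"
    using L by (simp add: A_def high_order_state_mat_def Let_def)
  \<comment> \<open>The block of the state matrix in block row k mod m, the only one where the
    current costate is nonzero, and block column i div n.\<close>
  define M where "M = (if k mod m = m - 1 then (if i div n = 0 then - L else 0\<^sub>m n n)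
        else if i div n = k mod m + 1 then 1\<^sub>m n else 0\<^sub>m n n)"
  have "costate A (pullback (high_order_output_mat m H) \<xi>) (Suc k) i
      = (\<Sum>h<n * m. (if h div n = k mod m then d (k div m) (h mod n) else 0) * A $$ (h, i))"
    using Suc.IH A by (auto simp: A_def d_def intro!: sum.cong)
  also have "\<dots> = (\<Sum>h<n * m. if h div n = k mod m then d (k div m) (h mod n) * M $$ (h mod n, i mod n) else 0)"
    using Suc.prems L by (intro sum.cong) (auto simp: A_def M_def high_order_state_mat_def Let_def)
  also have "\<dots> = (\<Sum>h<n. d (k div m) h * M $$ (h, i mod n))"
    using \<open>m \<ge> 1\<close> by (intro sum_block) simp
  also have "\<dots> = (if i div n = Suc k mod m then d (Suc k div m) (i mod n) else 0)"
  \<comment> \<open>From the last block the row wraps around to block 0, picks up - L and raises k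
    div m; from any other block the identity just moves it on. For m = 1 every step wraps.\<close>
  proof (cases "k mod m = m - 1")
    case True
    then have km: "Suc k mod m = 0" "Suc k div m = Suc (k div m)"
      using \<open>m \<ge> 1\<close> by (auto simp: mod_Suc div_Suc)
    show ?thesis using True L \<open>n > 0\<close> by (auto simp: M_def km d_def)
  next
    case False
    then have km: "Suc k mod m = Suc (k mod m)" "Suc k div m = k div m"
      using \<open>m \<ge> 1\<close> by (auto simp: mod_Suc div_Suc)
    have "(\<Sum>h<n. d (k div m) h * 1\<^sub>m n $$ (h, i mod n)) = (\<Sum>h<n. if h = i mod n then d (k div m) h else 0)"
      using \<open>n > 0\<close> by (intro sum.cong) auto
    then show ?thesis using False \<open>n > 0\<close> by (auto simp: M_def km)
  qed
  finally show ?case by (simp add: A_def d_def)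
qed

lemma output_rank_high_order:
  assumes L: "L \<in> carrier_mat n n" and B: "B \<in> carrier_mat n l" and H: "H \<in> carrier_mat p n" and "m \<ge> 1"
  shows "output_rank_condition (high_order_state_mat m L) (high_order_input_mat m B) (high_order_output_mat m H)
    \<longleftrightarrow> output_rank_condition (- L) B H"
proof -
  let ?F = "high_order_state_mat m L" and ?G = "high_order_input_mat m B" and ?J = "high_order_output_mat m H"
  have dims: "dim_row ?F = n * m" "dim_col ?G = l" "dim_row ?J = p" "dim_row (- L) = n" "dim_col B = l" "dim_row H = p"
    using L B H by (auto simp: high_order_state_mat_def high_order_input_mat_def high_order_output_mat_def Let_def)
  \<comment> \<open>The costate lives in block k mod m and the input enters in block m - 1, so they
    meet only when these coincide.\<close>
  have markov: "(\<Sum>i<n * m. costate ?F (pullback ?J \<xi>) k i * ?G $$ (i, j))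
      = (if k mod m = m - 1 then \<Sum>i<n. costate (- L) (pullback H \<xi>) (k div m) i * B $$ (i, j) else 0)"
    if j: "j < l" for \<xi> k j
  proof -
    have "(\<Sum>i<n * m. costate ?F (pullback ?J \<xi>) k i * ?G $$ (i, j))
        = (\<Sum>i<n * m. if i div n = k mod m then
            (if k mod m = m - 1 then costate (- L) (pullback H \<xi>) (k div m) (i mod n) * B $$ (i mod n, j) else 0) else 0)"
    proof (rule sum.cong)
      fix i assume "i \<in> {..<n * m}"
      then have i: "i < n * m" by simp
      then have "n > 0" by (cases n) auto
      then have "?G $$ (i, j) = (if i div n = m - 1 then B $$ (i mod n, j) else 0)"
        using i j B by (simp add: high_order_input_mat_def Let_def)
      then show "costate ?F (pullback ?J \<xi>) k i * ?G $$ (i, j) = (if i div n = k mod m then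
            (if k mod m = m - 1 then costate (- L) (pullback H \<xi>) (k div m) (i mod n) * B $$ (i mod n, j) else 0) else 0)"
        by (simp add: costate_high_order[OF L H \<open>m \<ge> 1\<close> i])
    qed simp
    also have "\<dots> = (\<Sum>i<n. if k mod m = m - 1 then costate (- L) (pullback H \<xi>) (k div m) i * B $$ (i, j) else 0)"
      using \<open>m \<ge> 1\<close> by (intro sum_block) simp
    finally show ?thesis by auto
  qed
  have "(\<forall>k. \<forall>j<l. (\<Sum>i<n * m. costate ?F (pullback ?J \<xi>) k i * ?G $$ (i, j)) = 0)
      \<longleftrightarrow> (\<forall>q. \<forall>j<l. (\<Sum>i<n. costate (- L) (pullback H \<xi>) q i * B $$ (i, j)) = 0)" (is "?l \<longleftrightarrow> ?r") for \<xi>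
  proof
    assume ?r
    then show ?l by (simp add: markov)
  next
    assume l: ?l
    show ?r
    proof (intro allI impI)
      fix q j assume "j < l"
      \<comment> \<open>Parameter q of the first-order system occurs at order q m + m - 1 of the
        high-order one. Naming m - 1 keeps truncated subtraction out of the division with
        remainder.\<close>
      define b where "b = m - 1"
      have "b < m" "m - 1 = b" using \<open>m \<ge> 1\<close> by (simp_all add: b_def)
      then have "(q * m + b) mod m = m - 1" "(q * m + b) div m = q" by auto
      with l[rule_format, OF \<open>j < l\<close>, of "q * m + b"] markov[OF \<open>j < l\<close>, of \<xi> "q * m + b"]
      show "(\<Sum>i<n. costate (- L) (pullback H \<xi>) q i * B $$ (i, j)) = 0" by simp
    qed
  qed
  then show ?thesis unfolding output_rank_condition_def dims by simp
qed

section \<open>Specialisation to the Laplacian, leader and target matrices of a graph\<close>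

theorem theorem3:
  fixes G :: "nat pair_pre_digraph" and w :: "nat \<times> nat \<Rightarrow> real"
    and n m :: nat and ls ts :: "nat list"
  assumes "pair_digraph G" and "pverts G = {0..<n}"
    and "distinct ls" and "set ls \<subseteq> pverts G"
    and "distinct ts" and "set ts \<subseteq> pverts G"
    and "m \<ge> 1"
  shows "target_controllable
           (high_order_state_mat m (laplacian n G w))
           (high_order_input_mat m (leader_mat n ls))
           (high_order_output_mat m (target_mat n ts))
         \<longleftrightarrow> target_controllable (- laplacian n G w) (leader_mat n ls) (target_mat n ts)"
proof -
  have L: "laplacian n G w \<in> carrier_mat n n" by (simp add: laplacian_def)
  have B: "leader_mat n ls \<in> carrier_mat n (length ls)" 
    unfolding leader_mat_def using mat_of_cols_carrier(1)[of n "map (unit_vec n) ls"] by simp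
  have H: "target_mat n ts \<in> carrier_mat (length ts) n" 
    unfolding target_mat_def using mat_of_rows_carrier(1)[of n "map (unit_vec n) ts"] by simp
  have "high_order_state_mat m (laplacian n G w) \<in> carrier_mat (n * m) (n * m)"
    "high_order_input_mat m (leader_mat n ls) \<in> carrier_mat (n * m) (length ls)"
    "high_order_output_mat m (target_mat n ts) \<in> carrier_mat (length ts) (n * m)"
    using L B H
    by (auto simp: high_order_state_mat_def high_order_input_mat_def high_order_output_mat_def Let_def)
  note high = target_controllable_iff_output_rank[OF this]
  have "- laplacian n G w \<in> carrier_mat n n" using L by simp
  note first = target_controllable_iff_output_rank[OF this B H]
  show ?thesis unfolding high first by (rule output_rank_high_order[OF L B H \<open>m \<ge> 1\<close>])
qed

end
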